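(* Let $X = (X_n)_{n\in\mathbb{Z}}$ be a stationary stochastic process of real-valued square-integrable random variables. Suppose that $$\sup_{N\ge 1}\Big(N\sum_{|n|\ge N}|\mathrm{Cov}(X_0,X_n)|\Big)<\infty$$ and $$\sum_{n\in\mathbb{Z}}\mathrm{Cov}(X_0,X_n)=0.$$ Then $X$ is linearly rigid, i.e. $X_0$ belongs to the closed linear span in $L^2(\Omega,\mathbb{P})$ of $\{X_n : n\in\mathbb{Z}\setminus\{0\}\}$.
   Context: The random variables $X_n$ are defined on a probability space $(\Omega,\mathbb{P})$. Stationarity is understood in the broad (second-order) sense: $\mathbb{E}(X_n)$ and $\mathbb{E}(X_nX_{n+k})$ do not depend on $n$, for every $k$. Here $\mathrm{Cov}(U,V)=\mathbb{E}(UV)-\mathbb{E}(U)\mathbb{E}(V)$. For a stationary process $X=(X_n)_{n\in\mathbb{Z}^d}$, let $\check{H}_0(X)\subset L^2(\Omega,\mathbb{P})$ be the closed linear span of $\{X_n: n\in\mathbb{Z}^d\setminus\{0\}\}$; $X$ is called linearly rigid if $X_0\in\check{H}_0(X)$. *)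

theory Defs
  imports "HOL-Probability.Probability"
begin

definition square_integrable :: "'a measure \<Rightarrow> ('a \<Rightarrow> real) \<Rightarrow> bool" where
  "square_integrable M f \<longleftrightarrow> f \<in> borel_measurable M \<and> integrable M (\<lambda>\<omega>. (f \<omega>)\<^sup>2)"

definition L2_norm :: "'a measure \<Rightarrow> ('a \<Rightarrow> real) \<Rightarrow> real" where
  "L2_norm M f = sqrt (\<integral>\<omega>. (f \<omega>)\<^sup>2 \<partial>M)"

definition Cov :: "'a measure \<Rightarrow> ('a \<Rightarrow> real) \<Rightarrow> ('a \<Rightarrow> real) \<Rightarrow> real" where
  "Cov M U V = (\<integral>\<omega>. U \<omega> * V \<omega> \<partial>M) - (\<integral>\<omega>. U \<omega> \<partial>M) * (\<integral>\<omega>. V \<omega> \<partial>M)"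

text \<open>Second-order (wide-sense) stationarity. The index group is abstract here, so that
  both \<open>int\<close> and \<open>int ^ 'd\<close> are instances.\<close>

definition stationary :: "'a measure \<Rightarrow> ('i::ab_group_add \<Rightarrow> 'a \<Rightarrow> real) \<Rightarrow> bool" where
  "stationary M X \<longleftrightarrow>
     (\<forall>m n. (\<integral>\<omega>. X m \<omega> \<partial>M) = (\<integral>\<omega>. X n \<omega> \<partial>M)) \<and>
     (\<forall>k m n. (\<integral>\<omega>. X m \<omega> * X (m + k) \<omega> \<partial>M) = (\<integral>\<omega>. X n \<omega> * X (n + k) \<omega> \<partial>M))"

definition lin_span :: "('a \<Rightarrow> real) set \<Rightarrow> ('a \<Rightarrow> real) set" where
  "lin_span S = {(\<lambda>\<omega>. \<Sum>f\<in>F. c f * f \<omega>) | F c. finite F \<and> F \<subseteq> S}"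

text \<open>Elements of \<open>L\<^sup>2\<close> are represented by square-integrable functions rather than by their
  almost-everywhere classes; the closure below is invariant under almost-everywhere equality
  of measurable functions. It is meant for sets \<open>S\<close> of square-integrable functions.\<close>

definition L2_closed_span :: "'a measure \<Rightarrow> ('a \<Rightarrow> real) set \<Rightarrow> ('a \<Rightarrow> real) set" where
  "L2_closed_span M S =
     {f. square_integrable M f \<and>
         (\<forall>\<epsilon>>0. \<exists>g\<in>lin_span S. L2_norm M (\<lambda>\<omega>. f \<omega> - g \<omega>) < \<epsilon>)}"

definition linearly_rigid :: "'a measure \<Rightarrow> ('i::ab_group_add \<Rightarrow> 'a \<Rightarrow> real) \<Rightarrow> bool" where
  "linearly_rigid M X \<longleftrightarrow> X 0 \<in> L2_closed_span M (X ` (UNIV - {0}))"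

end

theory Submission
  imports Defs
begin

text \<open>
  Write \<open>\<gamma> k\<close> for the covariance of \<open>X 0\<close> and \<open>X k\<close>. Rigidity says that finite combinations
  \<open>\<Sum> c n * X n\<close> with \<open>c 0 = 1\<close> can have arbitrarily small \<open>L\<^sup>2\<close> norm: moving \<open>X 0\<close> to the other side
  then approximates it by the remaining variables. Only combinations with \<open>\<Sum> c n = 0\<close> are
  considered, so that a nonzero mean of the process cancels and only \<open>\<gamma>\<close> matters. These
  combinations form a convex set \<open>K\<close>.

  Spectrally, the two hypotheses imply that the spectral density \<open>f\<close>, the Fourier series of \<open>\<gamma>\<close>,
  vanishes at \<open>0\<close> and is \<open>O(\<bar>\<theta>\<bar>)\<close> there, so that \<open>1/f\<close> is not integrable and Kolmogorov's
  criterion applies. The proof below replaces this by an elementary argument in three steps.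

  \<^item> Coefficients \<open>a n = bump (n / N)\<close>, sampled from a fixed piecewise linear function with value 1 at
    0 and integral 0, give elements \<open>A\<close> of \<open>K\<close> whose norms stay bounded as \<open>N\<close> grows
    (\<open>quadratic_form_bump_samples_le\<close>). Indeed the second moment is \<open>\<Sum>k. r k * \<gamma> k\<close> with \<open>r\<close> the
    autocorrelation of \<open>a\<close>; since \<open>\<gamma>\<close> has sum 0 one may replace \<open>r k\<close> by \<open>r k - r 0\<close>, which is
    of order \<open>min k\<^sup>2 N\<^sup>2 / N\<close> because \<open>a\<close> is Lipschitz with constant of order \<open>1/N\<close> on about \<open>N\<close>
    points, and the tail hypothesis bounds \<open>\<Sum>k. min k\<^sup>2 N\<^sup>2 * \<bar>\<gamma> k\<bar>\<close> by a multiple of \<open>N\<close>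
    (\<open>sum_min_square_le\<close>).
  \<^item> For fixed \<open>k\<close> the inner product of \<open>A\<close> with \<open>X k\<close> is \<open>\<Sum>j. a (j + k) * \<gamma> j\<close>, which tends to
    \<open>\<Sum>j. \<gamma> j = 0\<close> by dominated convergence. So the elements \<open>A\<close> tend to 0 weakly.
  \<^item> A convex set containing a norm-bounded sequence that is asymptotically orthogonal to each of
    its elements contains elements of arbitrarily small norm
    (\<open>convex_weakly_null_imp_small_norm\<close>).
\<close>

section \<open>Weighted absolute sums under the tail condition\<close>

text \<open>The odd numbers up to \<open>2m - 1\<close> add up to \<open>m\<^sup>2\<close>; here \<open>m\<close> is the minimum of \<open>\<bar>k\<bar>\<close> and \<open>N\<close>.
  In this form a weighted sum over \<open>k\<close> becomes a sum of tails.\<close>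

lemma min_square_layers:
  "(\<Sum>j\<in>{1..N}. if int j \<le> \<bar>k\<bar> then 2 * real j - 1 else 0) = real_of_int (min (k\<^sup>2) ((int N)\<^sup>2))"
proof (induction N)
  case 0
  then show ?case by simp
next
  case (Suc N)
  have split: "{1..Suc N} = insert (Suc N) {1..N}" by auto
  show ?case
  proof (cases "int (Suc N) \<le> \<bar>k\<bar>")
    case True
    then have "(int (Suc N))\<^sup>2 \<le> k\<^sup>2" "(int N)\<^sup>2 \<le> k\<^sup>2"
      by (simp_all add: abs_le_square_iff[symmetric])
    then have "min (k\<^sup>2) ((int (Suc N))\<^sup>2) = (int (Suc N))\<^sup>2" "min (k\<^sup>2) ((int N)\<^sup>2) = (int N)\<^sup>2"
      by simp_all
    with True Suc.IH show ?thesis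
      unfolding split by (simp add: power2_eq_square algebra_simps)
  next
    case False
    then have "k\<^sup>2 \<le> (int N)\<^sup>2" "k\<^sup>2 \<le> (int (Suc N))\<^sup>2"
      by (simp_all add: abs_le_square_iff[symmetric])
    with False Suc.IH show ?thesis
      unfolding split by simp
  qed
qed

text \<open>Exchanging the sums over layers \<open>j\<close> and over \<open>k\<close>, layer \<open>j\<close> contributes \<open>2j - 1\<close> times a tail
  of size at most \<open>C / j\<close>, hence at most \<open>2 * C\<close>. The tail hypothesis and the conclusion are
  stated for finite sets \<open>F\<close>, so that no summability has to be tracked.\<close>

lemma sum_min_square_le:
  fixes \<gamma> :: "int \<Rightarrow> real"
  assumes tail: "\<And>N F. N \<ge> 1 \<Longrightarrow> finite F \<Longrightarrow> (\<And>n. n \<in> F \<Longrightarrow> int N \<le> \<bar>n\<bar>)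
                   \<Longrightarrow> real N * (\<Sum>n\<in>F. \<bar>\<gamma> n\<bar>) \<le> C"
    and F: "finite F"
  shows "(\<Sum>k\<in>F. real_of_int (min (k\<^sup>2) ((int N)\<^sup>2)) * \<bar>\<gamma> k\<bar>) \<le> 2 * C * real N"
proof -
  have "(\<Sum>k\<in>F. real_of_int (min (k\<^sup>2) ((int N)\<^sup>2)) * \<bar>\<gamma> k\<bar>)
      = (\<Sum>k\<in>F. \<Sum>j\<in>{1..N}. (if int j \<le> \<bar>k\<bar> then 2 * real j - 1 else 0) * \<bar>\<gamma> k\<bar>)"
    by (simp only: min_square_layers[symmetric] sum_distrib_right)
  also have "\<dots> = (\<Sum>j\<in>{1..N}. \<Sum>k\<in>F. (if int j \<le> \<bar>k\<bar> then 2 * real j - 1 else 0) * \<bar>\<gamma> k\<bar>)"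
    by (rule sum.swap)
  also have "\<dots> \<le> (\<Sum>j\<in>{1..N}. 2 * C)"
  proof (rule sum_mono)
    fix j assume j: "j \<in> {1..N}"
    let ?G = "{k \<in> F. int j \<le> \<bar>k\<bar>}"
    have "(\<Sum>k\<in>F. (if int j \<le> \<bar>k\<bar> then 2 * real j - 1 else 0) * \<bar>\<gamma> k\<bar>)
        = (2 * real j - 1) * (\<Sum>k\<in>?G. \<bar>\<gamma> k\<bar>)"
      using F by (subst sum.inter_filter) (auto simp: sum_distrib_left intro!: sum.cong)
    also have "\<dots> \<le> 2 * (real j * (\<Sum>k\<in>?G. \<bar>\<gamma> k\<bar>))"
      by (simp add: algebra_simps sum_nonneg)
    also have "\<dots> \<le> 2 * C"
      using j F by (intro mult_left_mono tail) auto
    finally show "(\<Sum>k\<in>F. (if int j \<le> \<bar>k\<bar> then 2 * real j - 1 else 0) * \<bar>\<gamma> k\<bar>) \<le> 2 * C" .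
  qed
  finally show ?thesis by (simp add: mult_ac)
qed

section \<open>Test sequences sampled from a bump with vanishing integral\<close>

text \<open>A tent of height 1 on \<open>[-1, 1]\<close> minus its translate by 1. The translate vanishes at 0 and
  makes the integral zero; the tent has bounded slope, which a box function would not have, and
  with box functions the second moments are only controlled up to a logarithm of \<open>N\<close>.\<close>

definition bump :: "real \<Rightarrow> real" where
  "bump x = max 0 (1 - \<bar>x\<bar>) - max 0 (1 - \<bar>x - 1\<bar>)"

lemma bump_0 [simp]: "bump 0 = 1"
  by (simp add: bump_def)

lemma bump_sample_outside:
  assumes "N \<ge> 1" "n \<notin> {- int N..2 * int N}"
  shows "bump (real_of_int n / real N) = 0"
proof -
  have "real_of_int n \<le> - real N \<or> 2 * real N \<le> real_of_int n"
    using assms(2) by auto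
  then have "real_of_int n / real N \<le> -1 \<or> 2 \<le> real_of_int n / real N"
    using assms(1) by (simp add: field_simps)
  moreover have "bump x = 0" if "x \<le> -1 \<or> 2 \<le> x" for x
    using that by (auto simp: bump_def)
  ultimately show ?thesis by blast
qed

lemma bump_Lipschitz: "\<bar>bump x - bump y\<bar> \<le> 2 * \<bar>x - y\<bar>"
proof -
  have tent: "\<bar>max 0 (1 - \<bar>u\<bar>) - max 0 (1 - \<bar>v\<bar>)\<bar> \<le> \<bar>u - v\<bar>" for u v :: real
    by (simp add: max_def abs_if)
  show ?thesis
    using tent[of x y] tent[of "x - 1" "y - 1"] unfolding bump_def abs_le_iff by auto
qed

lemma abs_bump_le_1: "\<bar>bump x\<bar> \<le> 1"
proof -
  have tent: "0 \<le> max 0 (1 - \<bar>u\<bar>)" "max 0 (1 - \<bar>u\<bar>) \<le> 1" for u :: real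
    by simp_all
  show ?thesis
    using tent[of x] tent[of "x - 1"] unfolding bump_def abs_le_iff by linarith
qed

text \<open>The two tents are sampled at the same integer points up to a shift by \<open>N\<close>, so the integral
  being zero is inherited exactly by the sum over samples.\<close>

lemma sum_bump_samples:
  assumes N: "N \<ge> 1"
  shows "(\<Sum>n\<in>{- int N..2 * int N}. bump (real_of_int n / real N)) = 0"
proof -
  define t where "t n = max 0 (1 - \<bar>real_of_int n / real N\<bar>)" for n :: int
  have t0: "t n = 0" if "int N \<le> \<bar>n\<bar>" for n
  proof -
    have "real N \<le> \<bar>real_of_int n\<bar>" using that by linarith
    then show ?thesis using N by (simp add: t_def field_simps)
  qed
  have bt: "bump (real_of_int n / real N) = t n - t (n - int N)" for n
    using N by (simp add: bump_def t_def diff_divide_distrib)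
  have 1: "sum t {- int N..2 * int N} = sum t {- int N..int N}"
    by (rule sum.mono_neutral_right) (auto intro!: t0)
  have "(\<Sum>n\<in>{- int N..2 * int N}. t (n - int N)) = sum t {- 2 * int N..int N}"
    by (rule sum.reindex_bij_witness[of _ "\<lambda>n. n + int N" "\<lambda>n. n - int N"]) auto
  also have "\<dots> = sum t {- int N..int N}"
    by (rule sum.mono_neutral_right) (auto intro!: t0)
  finally show ?thesis
    by (simp add: bt sum_subtractf 1)
qed

lemma bump_samples_tendsto:
  "(\<lambda>N. bump (real_of_int n / real (Suc N))) \<longlonglongrightarrow> 1"
proof -
  have "isCont bump 0"
    unfolding bump_def by (intro continuous_intros)
  moreover have "(\<lambda>N. real_of_int n / real (Suc N)) \<longlonglongrightarrow> 0"
    by (rule LIMSEQ_Suc) (rule lim_const_over_n)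
  ultimately show ?thesis
    using isCont_tendsto_compose by fastforce
qed

section \<open>Quadratic forms of a summable kernel with sum zero\<close>

text \<open>By the translation invariance of \<open>\<Sum> (a n)\<^sup>2\<close>, twice the difference
  \<open>\<Sum> (a n)\<^sup>2 - \<Sum> a n * a (n + k)\<close> equals \<open>\<Sum> (a (n + k) - a n)\<^sup>2\<close>, whose nonzero terms lie in the
  union of two translates of \<open>S\<close>. The factors 2 cancel.\<close>

lemma autocorrelation_gap:
  fixes a :: "int \<Rightarrow> real"
  assumes S: "finite S" and supp: "\<And>n. n \<notin> S \<Longrightarrow> a n = 0"
    and b: "\<And>n. \<bar>a (n + k) - a n\<bar> \<le> b"
  shows "\<bar>(\<Sum>n\<in>S. a n * a (n + k)) - (\<Sum>n\<in>S. (a n)\<^sup>2)\<bar> \<le> real (card S) * b\<^sup>2"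
proof -
  define S' where "S' = (\<lambda>n. n - k) ` S"
  have memS': "n \<in> S' \<longleftrightarrow> n + k \<in> S" for n
    unfolding S'_def by force
  let ?U = "S \<union> S'"
  have U: "finite ?U" using S by (simp add: S'_def)
  have cU: "card ?U \<le> 2 * card S"
    using card_Un_le[of S S'] card_image_le[OF S, of "\<lambda>n. n - k"] by (simp add: S'_def)
  have r: "(\<Sum>n\<in>S. a n * a (n + k)) = (\<Sum>n\<in>?U. a n * a (n + k))"
    by (rule sum.mono_neutral_left) (use U supp in auto)
  have r0: "(\<Sum>n\<in>S. (a n)\<^sup>2) = (\<Sum>n\<in>?U. (a n)\<^sup>2)"
    by (rule sum.mono_neutral_left) (use U supp in auto)
  have "(\<Sum>n\<in>S. (a n)\<^sup>2) = (\<Sum>n\<in>S'. (a (n + k))\<^sup>2)"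
    unfolding S'_def by (subst sum.reindex) (auto simp: inj_on_def)
  also have "\<dots> = (\<Sum>n\<in>?U. (a (n + k))\<^sup>2)"
    by (rule sum.mono_neutral_left) (use U supp memS' in auto)
  finally have r0': "(\<Sum>n\<in>S. (a n)\<^sup>2) = (\<Sum>n\<in>?U. (a (n + k))\<^sup>2)" .
  have eq: "2 * ((\<Sum>n\<in>S. (a n)\<^sup>2) - (\<Sum>n\<in>S. a n * a (n + k))) = (\<Sum>n\<in>?U. (a (n + k) - a n)\<^sup>2)"
  proof -
    have "(\<Sum>n\<in>?U. (a (n + k) - a n)\<^sup>2)
        = (\<Sum>n\<in>?U. (a (n + k))\<^sup>2) + (\<Sum>n\<in>?U. (a n)\<^sup>2) - 2 * (\<Sum>n\<in>?U. a n * a (n + k))"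
      by (simp add: power2_diff sum.distrib sum_subtractf sum_distrib_left mult_ac)
    then show ?thesis using r r0 r0' by simp
  qed
  have "(\<Sum>n\<in>?U. (a (n + k) - a n)\<^sup>2) \<le> (\<Sum>n\<in>?U. b\<^sup>2)"
  proof (rule sum_mono)
    fix n
    show "(a (n + k) - a n)\<^sup>2 \<le> b\<^sup>2"
      using power_mono[OF b[of n], of 2] by simp
  qed
  also have "\<dots> \<le> real (2 * card S) * b\<^sup>2"
    using cU by (simp del: of_nat_mult add: mult_right_mono)
  finally have "(\<Sum>n\<in>?U. (a (n + k) - a n)\<^sup>2) \<le> 2 * (real (card S) * b\<^sup>2)" by simp
  moreover have "0 \<le> (\<Sum>n\<in>?U. (a (n + k) - a n)\<^sup>2)" by (simp add: sum_nonneg)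
  ultimately show ?thesis
    using eq unfolding abs_le_iff right_diff_distrib by (intro conjI) linarith+
qed

text \<open>The value \<open>v\<close> is the quadratic form \<open>\<Sum>m n. a m * a n * \<gamma> (n - m)\<close>, grouped by \<open>k = n - m\<close>.
  What matters is that the bound does not depend on \<open>N\<close>.\<close>

lemma quadratic_form_bump_samples_le:
  fixes \<gamma> :: "int \<Rightarrow> real" and N :: nat
  defines "a \<equiv> \<lambda>n. bump (real_of_int n / real N)"
    and "S \<equiv> {- int N..2 * int N}"
  assumes N: "N \<ge> 1"
    and tail: "\<And>N F. N \<ge> 1 \<Longrightarrow> finite F \<Longrightarrow> (\<And>n. n \<in> F \<Longrightarrow> int N \<le> \<bar>n\<bar>)
                   \<Longrightarrow> real N * (\<Sum>n\<in>F. \<bar>\<gamma> n\<bar>) \<le> C"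
    and zero: "(\<gamma> has_sum 0) UNIV"
    and v: "((\<lambda>k. (\<Sum>n\<in>S. a n * a (n + k)) * \<gamma> k) has_sum v) UNIV"
  shows "v \<le> 32 * C"
proof (rule has_sum_le_finite_sums)
  \<comment> \<open>\<open>q\<close> is the autocorrelation at lag 0; subtracting it is free because \<open>\<gamma>\<close> has sum 0.\<close>
  define q where "q = (\<Sum>n\<in>S. (a n)\<^sup>2)"
  have "((\<lambda>k. (\<Sum>n\<in>S. a n * a (n + k)) * \<gamma> k + (- q) * \<gamma> k) has_sum v + (- q) * 0) UNIV"
    by (intro has_sum_add has_sum_cmult_right v zero)
  then show "((\<lambda>k. ((\<Sum>n\<in>S. a n * a (n + k)) - q) * \<gamma> k) has_sum v) UNIV"
    by (simp add: algebra_simps)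
  have supp: "a n = 0" if "n \<notin> S" for n
    using that N unfolding a_def S_def by (intro bump_sample_outside) auto
  have gap: "\<bar>(\<Sum>n\<in>S. a n * a (n + k)) - q\<bar> \<le> 16 / real N * real_of_int (min (k\<^sup>2) ((int N)\<^sup>2))" for k
  proof -
    define m where "m = real_of_int (min \<bar>k\<bar> (int N))"
    have lip: "\<bar>a (n + k) - a n\<bar> \<le> 2 * m / real N" for n
    proof -
      have "\<bar>a (n + k) - a n\<bar> \<le> 2 * \<bar>real_of_int k\<bar> / real N"
        using bump_Lipschitz[of "real_of_int (n + k) / real N" "real_of_int n / real N"]
        by (simp add: a_def add_divide_distrib)
      moreover have "\<bar>a (n + k) - a n\<bar> \<le> 2 * real N / real N"
        using abs_bump_le_1[of "real_of_int (n + k) / real N"] abs_bump_le_1[of "real_of_int n / real N"] N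
        by (simp add: a_def)
      ultimately show ?thesis
        unfolding m_def by (simp add: min_def)
    qed
    have m2: "m\<^sup>2 = real_of_int (min (k\<^sup>2) ((int N)\<^sup>2))"
      unfolding m_def using abs_le_square_iff[of k "int N"] by (auto simp: min_def)
    have "card S \<le> 4 * N" using N by (simp add: S_def)
    then have cS: "real (card S) \<le> 4 * real N" by linarith
    have "\<bar>(\<Sum>n\<in>S. a n * a (n + k)) - q\<bar> \<le> real (card S) * (2 * m / real N)\<^sup>2"
      unfolding q_def 
      by (rule autocorrelation_gap[of S a, OF _ supp lip]) (simp_all add: S_def)
    also have "\<dots> \<le> 4 * real N * (2 * m / real N)\<^sup>2"
      by (rule mult_right_mono[OF cS]) simp
    also have "\<dots> = 16 / real N * m\<^sup>2"
      using N by (simp add: power2_eq_square field_simps)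
    finally show ?thesis by (simp only: m2)
  qed
  fix F :: "int set" assume F: "finite F"
  have "(\<Sum>k\<in>F. ((\<Sum>n\<in>S. a n * a (n + k)) - q) * \<gamma> k)
      \<le> (\<Sum>k\<in>F. 16 / real N * (real_of_int (min (k\<^sup>2) ((int N)\<^sup>2)) * \<bar>\<gamma> k\<bar>))"
  proof (rule sum_mono)
    fix k
    have "((\<Sum>n\<in>S. a n * a (n + k)) - q) * \<gamma> k \<le> \<bar>(\<Sum>n\<in>S. a n * a (n + k)) - q\<bar> * \<bar>\<gamma> k\<bar>"
      by (metis abs_ge_self abs_mult)
    also have "\<dots> \<le> (16 / real N * real_of_int (min (k\<^sup>2) ((int N)\<^sup>2))) * \<bar>\<gamma> k\<bar>"
      by (rule mult_right_mono[OF gap]) simp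
    finally show "((\<Sum>n\<in>S. a n * a (n + k)) - q) * \<gamma> k
        \<le> 16 / real N * (real_of_int (min (k\<^sup>2) ((int N)\<^sup>2)) * \<bar>\<gamma> k\<bar>)"
      by (simp only: mult.assoc)
  qed
  also have "\<dots> \<le> 16 / real N * (2 * C * real N)"
    unfolding sum_distrib_left[symmetric]
    by (rule mult_left_mono[OF sum_min_square_le[OF tail F]]) auto
  also have "\<dots> = 32 * C" using N by simp
  finally show "(\<Sum>k\<in>F. ((\<Sum>n\<in>S. a n * a (n + k)) - q) * \<gamma> k) \<le> 32 * C" .
qed

lemma has_sum_finite_sum:
  fixes f :: "'i \<Rightarrow> 'j \<Rightarrow> 'b::topological_comm_monoid_add"
  assumes "finite S" "\<And>n. n \<in> S \<Longrightarrow> (f n has_sum s n) A"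
  shows "((\<lambda>j. \<Sum>n\<in>S. f n j) has_sum (\<Sum>n\<in>S. s n)) A"
  using assms by (induction S rule: finite_induct) (simp_all add: has_sum_add)

text \<open>Dominated convergence for the counting measure: summability of a real family is absolute, so
  \<open>B * \<bar>\<gamma> j\<bar>\<close> is an integrable majorant.\<close>

lemma has_sum_dominated_tendsto:
  fixes \<gamma> :: "'i \<Rightarrow> real"
  assumes \<gamma>: "(\<gamma> has_sum s) A"
    and bdd: "\<And>N j. \<bar>b N j\<bar> \<le> B"
    and lim: "\<And>j. (\<lambda>N. b N j) \<longlonglongrightarrow> 1"
    and v: "\<And>N. ((\<lambda>j. b N j * \<gamma> j) has_sum v N) A"
  shows "v \<longlonglongrightarrow> s"
proof -
  have abs: "Infinite_Set_Sum.abs_summable_on f A" and val: "(\<integral>j. f j \<partial>count_space A) = x"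
    if "(f has_sum x) A" for f :: "'i \<Rightarrow> real" and x
  proof -
    have "f summable_on A" using that by (rule has_sum_imp_summable)
    then show abs: "Infinite_Set_Sum.abs_summable_on f A"
      by (rule summable_on_iff_abs_summable_on_real[THEN iffD1, THEN abs_summable_equivalent[THEN iffD1]])
    show "(\<integral>j. f j \<partial>count_space A) = x"
      using infsetsum_infsum[OF abs] infsumI[OF that] by (simp add: infsetsum_def)
  qed
  have "(\<lambda>N. \<integral>j. b N j * \<gamma> j \<partial>count_space A) \<longlonglongrightarrow> (\<integral>j. \<gamma> j \<partial>count_space A)"
  proof (rule integral_dominated_convergence[where w = "\<lambda>j. B * \<bar>\<gamma> j\<bar>"])
    show "integrable (count_space A) (\<lambda>j. B * \<bar>\<gamma> j\<bar>)"
      using abs[OF \<gamma>] by (auto simp: Infinite_Set_Sum.abs_summable_on_def)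
    show "AE j in count_space A. (\<lambda>N. b N j * \<gamma> j) \<longlonglongrightarrow> \<gamma> j"
      using tendsto_mult_right[OF lim] by simp
    show "AE j in count_space A. norm (b N j * \<gamma> j) \<le> B * \<bar>\<gamma> j\<bar>" for N
      by (simp add: abs_mult mult_right_mono bdd)
  qed simp_all
  then show ?thesis
    by (simp add: val[OF \<gamma>] val[OF v])
qed

section \<open>Minimal norm in a convex set of square-integrable functions\<close>

lemma square_integrable_mult:
  assumes "square_integrable M f" "square_integrable M g"
  shows "integrable M (\<lambda>\<omega>. f \<omega> * g \<omega> :: real)"
proof (rule Bochner_Integration.integrable_bound)
  show "integrable M (\<lambda>\<omega>. (f \<omega>)\<^sup>2 + (g \<omega>)\<^sup>2)"
    using assms by (simp add: square_integrable_def)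
  show "(\<lambda>\<omega>. f \<omega> * g \<omega>) \<in> borel_measurable M"
    using assms unfolding square_integrable_def by (intro borel_measurable_times) auto
  have "\<bar>x * y\<bar> \<le> x\<^sup>2 + y\<^sup>2" for x y :: real
  proof -
    have "0 \<le> (\<bar>x\<bar> - \<bar>y\<bar>)\<^sup>2" by simp
    then have "2 * \<bar>x * y\<bar> \<le> x\<^sup>2 + y\<^sup>2"
      by (simp add: power2_diff abs_mult mult.assoc)
    then show ?thesis by simp
  qed
  then show "AE \<omega> in M. norm (f \<omega> * g \<omega>) \<le> norm ((f \<omega>)\<^sup>2 + (g \<omega>)\<^sup>2)"
    by simp
qed

text \<open>Let \<open>d\<close> be the infimum of the squared norms on \<open>K\<close>. Moving a near-minimizer a proportion \<open>t\<close>
  of the way towards \<open>A N\<close> stays in \<open>K\<close>; expanding the square, the mixed term disappears as \<open>N\<close>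
  grows, and \<open>d \<le> (1 - t)\<^sup>2 * d + t\<^sup>2 * C\<close> remains. For small \<open>t\<close> the loss \<open>2 * t * d\<close> is of first
  order and the gain is of second order, which forces \<open>d = 0\<close>.\<close>

lemma convex_weakly_null_imp_small_norm:
  fixes K :: "('a \<Rightarrow> real) set"
  assumes sq: "\<And>f. f \<in> K \<Longrightarrow> square_integrable M f"
    and convex: "\<And>f g t. f \<in> K \<Longrightarrow> g \<in> K \<Longrightarrow> 0 \<le> t \<Longrightarrow> t \<le> 1
                   \<Longrightarrow> (\<lambda>\<omega>. (1 - t) * f \<omega> + t * g \<omega>) \<in> K"
    and A: "\<And>N. A N \<in> K"
    and bdd: "\<And>N::nat. (\<integral>\<omega>. (A N \<omega>)\<^sup>2 \<partial>M) \<le> C"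
    and weak: "\<And>f. f \<in> K \<Longrightarrow> (\<lambda>N. \<integral>\<omega>. f \<omega> * A N \<omega> \<partial>M) \<longlonglongrightarrow> 0"
    and \<epsilon>: "\<epsilon> > 0"
  shows "\<exists>f\<in>K. (\<integral>\<omega>. (f \<omega>)\<^sup>2 \<partial>M) < \<epsilon>"
proof -
  define E where "E f = (\<integral>\<omega>. (f \<omega>)\<^sup>2 \<partial>M)" for f :: "'a \<Rightarrow> real"
  define d where "d = Inf (E ` K)"
  have ne: "E ` K \<noteq> {}" using A by blast
  have bb: "bdd_below (E ` K)" by (rule bdd_belowI[of _ 0]) (auto simp: E_def)
  have d_le: "d \<le> E f" if "f \<in> K" for f
    unfolding d_def using that bb by (intro cInf_lower) auto
  have step: "d \<le> (1 - t)\<^sup>2 * E f + t\<^sup>2 * C" if f: "f \<in> K" and t: "0 < t" "t < 1" for f t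
  proof (rule LIMSEQ_le_const)
    let ?i = "\<lambda>N. \<integral>\<omega>. f \<omega> * A N \<omega> \<partial>M"
    have "(\<lambda>N. (1 - t)\<^sup>2 * E f + 2 * (1 - t) * t * ?i N + t\<^sup>2 * C)
        \<longlonglongrightarrow> (1 - t)\<^sup>2 * E f + 2 * (1 - t) * t * 0 + t\<^sup>2 * C"
      by (intro tendsto_intros weak f)
    then show "(\<lambda>N. (1 - t)\<^sup>2 * E f + 2 * (1 - t) * t * ?i N + t\<^sup>2 * C)
        \<longlonglongrightarrow> (1 - t)\<^sup>2 * E f + t\<^sup>2 * C" by simp
    have "d \<le> (1 - t)\<^sup>2 * E f + 2 * (1 - t) * t * ?i N + t\<^sup>2 * C" for N
    proof -
      have i: "integrable M (\<lambda>\<omega>. (f \<omega>)\<^sup>2)" "integrable M (\<lambda>\<omega>. (A N \<omega>)\<^sup>2)"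
        "integrable M (\<lambda>\<omega>. f \<omega> * A N \<omega>)"
        using sq[OF f] sq[OF A[of N]] square_integrable_mult[OF sq[OF f] sq[OF A[of N]]]
        by (simp_all add: square_integrable_def)
      have "d \<le> E (\<lambda>\<omega>. (1 - t) * f \<omega> + t * A N \<omega>)"
        using t by (intro d_le convex f A) auto
      also have "\<dots> = (\<integral>\<omega>. (1 - t)\<^sup>2 * (f \<omega>)\<^sup>2 + 2 * (1 - t) * t * (f \<omega> * A N \<omega>)
                          + t\<^sup>2 * (A N \<omega>)\<^sup>2 \<partial>M)"
        unfolding E_def
        by (rule Bochner_Integration.integral_cong) (auto simp: power2_eq_square algebra_simps)
      also have "\<dots> = (1 - t)\<^sup>2 * E f + 2 * (1 - t) * t * ?i N + t\<^sup>2 * E (A N)"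
        using i by (simp add: E_def)
      also have "\<dots> \<le> (1 - t)\<^sup>2 * E f + 2 * (1 - t) * t * ?i N + t\<^sup>2 * C"
        using bdd[of N] by (simp add: E_def mult_left_mono)
      finally show ?thesis .
    qed
    then show "\<exists>n. \<forall>N\<ge>n. d \<le> (1 - t)\<^sup>2 * E f + 2 * (1 - t) * t * ?i N + t\<^sup>2 * C" by blast
  qed
  have lin: "2 * d \<le> t * (C + d)" if t: "0 < t" "t < 1" for t
  proof -
    have "(d - t\<^sup>2 * C) / (1 - t)\<^sup>2 \<le> E f" if "f \<in> K" for f
      using step[OF that t] t by (simp add: field_simps)
    then have "(d - t\<^sup>2 * C) / (1 - t)\<^sup>2 \<le> d"
      unfolding d_def by (intro cInf_greatest ne) auto
    then have "d - t\<^sup>2 * C \<le> (1 - t)\<^sup>2 * d"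
      using t by (simp add: field_simps)
    then have "t * (2 * d) \<le> t * (t * (C + d))"
      by (simp add: power2_eq_square algebra_simps)
    then show ?thesis using t by simp
  qed
  have "2 * d \<le> 0"
  proof (rule tendsto_lowerbound)
    show "((\<lambda>t. t * (C + d)) \<longlongrightarrow> 0) (at_right 0)"
      by (auto intro!: tendsto_eq_intros)
    show "\<forall>\<^sub>F t in at_right 0. 2 * d \<le> t * (C + d)"
      using lin by (auto simp: eventually_at_right_field intro!: exI[of _ 1])
  qed simp
  then have "Inf (E ` K) < \<epsilon>" using \<epsilon> by (simp add: d_def)
  then show ?thesis
    using cInf_lessD[OF ne] by (auto simp: E_def)
qed

section \<open>Linear combinations of a stationary sequence\<close>

lemma square_integrable_lincomb:
  assumes "\<And>n. n \<in> S \<Longrightarrow> square_integrable M (X n)"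
  shows "square_integrable M (\<lambda>\<omega>. \<Sum>n\<in>S. c n * X n \<omega>)"
  unfolding square_integrable_def
proof
  show "(\<lambda>\<omega>. \<Sum>n\<in>S. c n * X n \<omega>) \<in> borel_measurable M"
    using assms unfolding square_integrable_def
    by (intro borel_measurable_sum borel_measurable_times) auto
  have "integrable M (\<lambda>\<omega>. \<Sum>i\<in>S. \<Sum>j\<in>S. (c i * c j) * (X i \<omega> * X j \<omega>))"
    by (intro Bochner_Integration.integrable_sum integrable_mult_right square_integrable_mult assms)
  then show "integrable M (\<lambda>\<omega>. (\<Sum>n\<in>S. c n * X n \<omega>)\<^sup>2)"
    by (simp add: power2_eq_square sum_product mult_ac)
qed

lemma integral_lincomb_mult:
  fixes f :: "'a \<Rightarrow> real"
  assumes "\<And>n. n \<in> S \<Longrightarrow> square_integrable M (X n)" "square_integrable M f"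
  shows "(\<integral>\<omega>. (\<Sum>n\<in>S. c n * X n \<omega>) * f \<omega> \<partial>M) = (\<Sum>n\<in>S. c n * (\<integral>\<omega>. X n \<omega> * f \<omega> \<partial>M))"
proof -
  have "(\<integral>\<omega>. (\<Sum>n\<in>S. c n * X n \<omega>) * f \<omega> \<partial>M) = (\<integral>\<omega>. (\<Sum>n\<in>S. c n * (X n \<omega> * f \<omega>)) \<partial>M)"
    by (simp add: sum_distrib_right mult.assoc)
  also have "\<dots> = (\<Sum>n\<in>S. \<integral>\<omega>. c n * (X n \<omega> * f \<omega>) \<partial>M)"
    by (intro Bochner_Integration.integral_sum integrable_mult_right square_integrable_mult assms)
  finally show ?thesis by simp
qed

lemma stationary_expectation_mult:
  assumes "stationary M X"
  shows "(\<integral>\<omega>. X k \<omega> * X n \<omega> \<partial>M) = Cov M (X 0) (X (n - k)) + (\<integral>\<omega>. X 0 \<omega> \<partial>M)\<^sup>2"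
proof -
  have "(\<integral>\<omega>. X k \<omega> * X (k + (n - k)) \<omega> \<partial>M) = (\<integral>\<omega>. X 0 \<omega> * X (0 + (n - k)) \<omega> \<partial>M)"
    "(\<integral>\<omega>. X (n - k) \<omega> \<partial>M) = (\<integral>\<omega>. X 0 \<omega> \<partial>M)"
    using assms unfolding stationary_def by blast+
  then show ?thesis by (simp add: Cov_def power2_eq_square)
qed

text \<open>The coefficients have sum zero, so the square of the mean drops out and only covariances
  remain. The finite sum is written as a sum over all lags \<open>j = n - k\<close>, which makes
  the index set of the covariances independent of the coefficients and of \<open>k\<close>.\<close>

lemma has_sum_correlation_with_lincomb:
  fixes X :: "int \<Rightarrow> 'a \<Rightarrow> real"
  assumes sq: "\<And>n. square_integrable M (X n)" and st: "stationary M X"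
    and S: "finite S" and supp: "\<And>n. n \<notin> S \<Longrightarrow> a n = 0" and sum0: "sum a S = 0"
  shows "((\<lambda>j. a (j + k) * Cov M (X 0) (X j)) has_sum
           (\<integral>\<omega>. X k \<omega> * (\<Sum>n\<in>S. a n * X n \<omega>) \<partial>M)) UNIV"
proof (rule has_sum_finite_neutralI)
  show "finite ((\<lambda>n. n - k) ` S)" using S by simp
  show "a (j + k) * Cov M (X 0) (X j) = 0" if "j \<in> UNIV - (\<lambda>n. n - k) ` S" for j
  proof -
    have "j + k \<notin> S" using that by force
    then show ?thesis by (simp add: supp)
  qed
  have "(\<integral>\<omega>. X k \<omega> * (\<Sum>n\<in>S. a n * X n \<omega>) \<partial>M) = (\<Sum>n\<in>S. a n * (\<integral>\<omega>. X n \<omega> * X k \<omega> \<partial>M))"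
    using integral_lincomb_mult[of S M X "X k" a] sq by (simp add: mult.commute)
  also have "\<dots> = (\<Sum>n\<in>S. a n * (\<integral>\<omega>. X k \<omega> * X n \<omega> \<partial>M))"
    by (simp add: mult.commute)
  also have "\<dots> = (\<Sum>n\<in>S. a n * Cov M (X 0) (X (n - k))) + sum a S * (\<integral>\<omega>. X 0 \<omega> \<partial>M)\<^sup>2"
    by (simp add: stationary_expectation_mult[OF st] distrib_left sum.distrib sum_distrib_right)
  also have "\<dots> = (\<Sum>n\<in>S. a n * Cov M (X 0) (X (n - k)))" using sum0 by simp
  also have "\<dots> = (\<Sum>j\<in>(\<lambda>n. n - k) ` S. a (j + k) * Cov M (X 0) (X j))"
    by (subst sum.reindex) (auto simp: inj_on_def)
  finally show "(\<integral>\<omega>. X k \<omega> * (\<Sum>n\<in>S. a n * X n \<omega>) \<partial>M)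
      = (\<Sum>j\<in>(\<lambda>n. n - k) ` S. a (j + k) * Cov M (X 0) (X j))" .
qed simp

text \<open>The approximation errors \<open>X 0 - g\<close>, where \<open>g\<close> combines the other variables, subject to total
  coefficient sum zero. Letting \<open>c\<close> vanish off \<open>S\<close> allows two such combinations to be added on
  a common larger index set.\<close>

definition zero_sum_interpolants :: "(int \<Rightarrow> 'a \<Rightarrow> real) \<Rightarrow> ('a \<Rightarrow> real) set" where
  "zero_sum_interpolants X = {(\<lambda>\<omega>. \<Sum>n\<in>S. c n * X n \<omega>) | S c.
     finite S \<and> (\<forall>n. n \<notin> S \<longrightarrow> c n = 0) \<and> c 0 = 1 \<and> sum c S = 0}"

lemma zero_sum_interpolants_convex:
  assumes f: "f \<in> zero_sum_interpolants X" and g: "g \<in> zero_sum_interpolants X"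
  shows "(\<lambda>\<omega>. (1 - t) * f \<omega> + t * g \<omega>) \<in> zero_sum_interpolants X"
proof -
  obtain S c where S: "finite S" "\<And>n. n \<notin> S \<Longrightarrow> c n = 0" "c 0 = 1" "sum c S = 0"
    and fS: "f = (\<lambda>\<omega>. \<Sum>n\<in>S. c n * X n \<omega>)"
    using f by (auto simp: zero_sum_interpolants_def)
  obtain T d where T: "finite T" "\<And>n. n \<notin> T \<Longrightarrow> d n = 0" "d 0 = 1" "sum d T = 0"
    and gT: "g = (\<lambda>\<omega>. \<Sum>n\<in>T. d n * X n \<omega>)"
    using g by (auto simp: zero_sum_interpolants_def)
  let ?U = "S \<union> T" and ?e = "\<lambda>n. (1 - t) * c n + t * d n"
  have c: "(\<Sum>n\<in>?U. c n * y n) = (\<Sum>n\<in>S. c n * y n)" for y :: "int \<Rightarrow> real"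
    by (rule sum.mono_neutral_right) (use S T in auto)
  have d: "(\<Sum>n\<in>?U. d n * y n) = (\<Sum>n\<in>T. d n * y n)" for y :: "int \<Rightarrow> real"
    by (rule sum.mono_neutral_right) (use S T in auto)
  have e: "(\<Sum>n\<in>?U. ?e n * y n) = (1 - t) * (\<Sum>n\<in>S. c n * y n) + t * (\<Sum>n\<in>T. d n * y n)"
    for y :: "int \<Rightarrow> real"
    unfolding c[symmetric] d[symmetric]
    by (simp add: distrib_right sum.distrib sum_distrib_left mult.assoc)
  have "(\<lambda>\<omega>. (1 - t) * f \<omega> + t * g \<omega>) = (\<lambda>\<omega>. \<Sum>n\<in>?U. ?e n * X n \<omega>)"
    by (simp add: e fS gT)
  moreover have "sum ?e ?U = 0"
    using e[of "\<lambda>_. 1"] S T by simp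
  ultimately show ?thesis
    unfolding zero_sum_interpolants_def using S T
    by (intro CollectI exI[of _ ?U] exI[of _ ?e]) auto
qed

lemma linearly_rigid_if_small_interpolants:
  fixes X :: "int \<Rightarrow> 'a \<Rightarrow> real"
  assumes sq: "square_integrable M (X 0)"
    and small: "\<And>\<epsilon>. \<epsilon> > 0 \<Longrightarrow> \<exists>f\<in>zero_sum_interpolants X. (\<integral>\<omega>. (f \<omega>)\<^sup>2 \<partial>M) < \<epsilon>"
  shows "linearly_rigid M X"
  unfolding linearly_rigid_def L2_closed_span_def
proof (intro CollectI conjI allI impI)
  show "square_integrable M (X 0)" by (rule sq)
  fix \<epsilon> :: real assume \<epsilon>: "\<epsilon> > 0"
  then obtain S c where S: "finite S" "\<And>n. n \<notin> S \<Longrightarrow> c n = 0" "c 0 = 1"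
    and lt: "(\<integral>\<omega>. (\<Sum>n\<in>S. c n * X n \<omega>)\<^sup>2 \<partial>M) < \<epsilon>\<^sup>2"
    using small[of "\<epsilon>\<^sup>2"] by (auto simp: zero_sum_interpolants_def)
  \<comment> \<open>The linear span is formed over the set of functions \<open>X n\<close>, and \<open>X\<close> may fail to be injective,
    so the coefficients of equal functions are collected in \<open>e\<close>.\<close>
  define T where "T = S - {0}"
  have T: "finite T" using S by (simp add: T_def)
  define e where "e f = (\<Sum>n\<in>{n \<in> T. X n = f}. - c n)" for f
  define g where "g \<omega> = (\<Sum>f\<in>X ` T. e f * f \<omega>)" for \<omega>
  have g_eq: "g \<omega> = - (\<Sum>n\<in>T. c n * X n \<omega>)" for \<omega>
  proof -
    have "(\<Sum>n\<in>T. - c n * X n \<omega>) = (\<Sum>f\<in>X ` T. \<Sum>n\<in>{n \<in> T. X n = f}. - c n * X n \<omega>)"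
      by (rule sum.image_gen[OF T])
    also have "\<dots> = g \<omega>"
      unfolding g_def e_def by (intro sum.cong refl) (auto simp: sum_distrib_right)
    finally show ?thesis by (simp add: sum_negf)
  qed
  have "0 \<in> S" using S by force
  then have "X 0 \<omega> - g \<omega> = (\<Sum>n\<in>S. c n * X n \<omega>)" for \<omega>
    using S by (simp add: g_eq T_def sum.remove[of S 0])
  then have "L2_norm M (\<lambda>\<omega>. X 0 \<omega> - g \<omega>) < \<epsilon>"
    using real_sqrt_less_mono[OF lt] \<epsilon> by (simp add: L2_norm_def)
  moreover have "g \<in> lin_span (X ` (UNIV - {0}))"
    unfolding lin_span_def g_def using T
    by (intro CollectI exI[of _ "X ` T"] exI[of _ e]) (auto simp: T_def)
  ultimately show "\<exists>g\<in>lin_span (X ` (UNIV - {0})). L2_norm M (\<lambda>\<omega>. X 0 \<omega> - g \<omega>) < \<epsilon>" by blast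
qed

section \<open>Linear rigidity\<close>

lemma finite_tail_le_SUP:
  fixes \<gamma> :: "int \<Rightarrow> real"
  defines "U \<equiv> (SUP N\<in>{1::nat..}. of_nat N *
             (\<Sum>\<^sub>\<infinity>n\<in>{n::int. int N \<le> \<bar>n\<bar>}. ennreal \<bar>\<gamma> n\<bar>))"
  assumes fin: "U < \<infinity>"
    and N: "N \<ge> 1" and F: "finite F" "\<And>n. n \<in> F \<Longrightarrow> int N \<le> \<bar>n\<bar>"
  shows "real N * (\<Sum>n\<in>F. \<bar>\<gamma> n\<bar>) \<le> enn2real U"
proof -
  have U: "U = ennreal (enn2real U)" using fin by simp
  have "ennreal (real N * (\<Sum>n\<in>F. \<bar>\<gamma> n\<bar>)) = of_nat N * (\<Sum>\<^sub>\<infinity>n\<in>F. ennreal \<bar>\<gamma> n\<bar>)"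
    using F by (simp add: ennreal_mult sum_nonneg ennreal_of_nat_eq_real_of_nat)
  also have "\<dots> \<le> of_nat N * (\<Sum>\<^sub>\<infinity>n\<in>{n::int. int N \<le> \<bar>n\<bar>}. ennreal \<bar>\<gamma> n\<bar>)"
    using F by (intro mult_left_mono infsum_mono_neutral nonneg_summable_on_complete) auto
  also have "\<dots> \<le> U"
    unfolding U_def using N by (intro SUP_upper) auto
  finally have "ennreal (real N * (\<Sum>n\<in>F. \<bar>\<gamma> n\<bar>)) \<le> ennreal (enn2real U)"
    using U by simp
  then show ?thesis by simp
qed

theorem theorem3p1:
  fixes M :: "'a measure" and X :: "int \<Rightarrow> 'a \<Rightarrow> real"
  assumes "prob_space M"
    and "\<And>n. square_integrable M (X n)"
    and "stationary M X"
    and "(SUP N\<in>{1::nat..}. of_nat N *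
            (\<Sum>\<^sub>\<infinity>n\<in>{n::int. int N \<le> \<bar>n\<bar>}. ennreal \<bar>Cov M (X 0) (X n)\<bar>)) < \<infinity>"
    and "((\<lambda>n::int. Cov M (X 0) (X n)) has_sum 0) UNIV"
  shows "linearly_rigid M X"
proof (rule linearly_rigid_if_small_interpolants)
  note sq = assms(2) and st = assms(3)
  show "square_integrable M (X 0)" by (rule sq)
  define \<gamma> where "\<gamma> n = Cov M (X 0) (X n)" for n
  have zero: "(\<gamma> has_sum 0) UNIV" using assms(5) by (simp add: \<gamma>_def[abs_def])
  note tail = finite_tail_le_SUP[OF assms(4)[folded \<gamma>_def]]
  define C where "C = enn2real (SUP N\<in>{1::nat..}. of_nat N *
             (\<Sum>\<^sub>\<infinity>n\<in>{n::int. int N \<le> \<bar>n\<bar>}. ennreal \<bar>\<gamma> n\<bar>))"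
  note tail = tail[folded C_def]
  \<comment> \<open>The scale is \<open>N + 1\<close>, so that it is positive for every index \<open>N\<close> of the sequence.\<close>
  define a where "a N n = bump (real_of_int n / real (Suc N))" for N n
  define S where "S N = {- int (Suc N)..2 * int (Suc N)}" for N
  define A where "A N = (\<lambda>\<omega>. \<Sum>n\<in>S N. a N n * X n \<omega>)" for N
  have S: "finite (S N)" for N by (simp add: S_def)
  have supp: "a N n = 0" if "n \<notin> S N" for N n
    using that unfolding a_def S_def by (intro bump_sample_outside) simp_all
  have sum0: "sum (a N) (S N) = 0" for N
    using sum_bump_samples[of "Suc N"] by (simp add: a_def[abs_def] S_def)
  have sqA: "square_integrable M (A N)" for N
    unfolding A_def by (rule square_integrable_lincomb[OF sq])
  have corr: "((\<lambda>j. a N (j + k) * \<gamma> j) has_sum (\<integral>\<omega>. X k \<omega> * A N \<omega> \<partial>M)) UNIV" for N k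
    unfolding \<gamma>_def A_def by (rule has_sum_correlation_with_lincomb[OF sq st S supp sum0])

  fix \<epsilon> :: real assume "\<epsilon> > 0"
  show "\<exists>f\<in>zero_sum_interpolants X. (\<integral>\<omega>. (f \<omega>)\<^sup>2 \<partial>M) < \<epsilon>"
  proof (rule convex_weakly_null_imp_small_norm[where A = A and C = "32 * C", OF _ _ _ _ _ \<open>\<epsilon> > 0\<close>])
    show "square_integrable M f" if "f \<in> zero_sum_interpolants X" for f
      using that square_integrable_lincomb[OF sq] by (auto simp: zero_sum_interpolants_def)
    show "(\<lambda>\<omega>. (1 - t) * f \<omega> + t * g \<omega>) \<in> zero_sum_interpolants X"
      if "f \<in> zero_sum_interpolants X" "g \<in> zero_sum_interpolants X" for f g t
      using that by (rule zero_sum_interpolants_convex)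
    show "A N \<in> zero_sum_interpolants X" for N
      unfolding zero_sum_interpolants_def A_def
      using S supp sum0 by (intro CollectI exI[of _ "S N"] exI[of _ "a N"]) (auto simp: a_def)
    show "(\<integral>\<omega>. (A N \<omega>)\<^sup>2 \<partial>M) \<le> 32 * C" for N
    proof -
      have "(\<integral>\<omega>. (A N \<omega>)\<^sup>2 \<partial>M) = (\<integral>\<omega>. (\<Sum>n\<in>S N. a N n * X n \<omega>) * A N \<omega> \<partial>M)"
        by (simp add: A_def power2_eq_square)
      also have "\<dots> = (\<Sum>n\<in>S N. a N n * (\<integral>\<omega>. X n \<omega> * A N \<omega> \<partial>M))"
        by (rule integral_lincomb_mult[OF sq sqA])
      finally have eq: "(\<integral>\<omega>. (A N \<omega>)\<^sup>2 \<partial>M) = (\<Sum>n\<in>S N. a N n * (\<integral>\<omega>. X n \<omega> * A N \<omega> \<partial>M))" .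
      have "((\<lambda>j. \<Sum>n\<in>S N. a N n * (a N (j + n) * \<gamma> j)) has_sum (\<integral>\<omega>. (A N \<omega>)\<^sup>2 \<partial>M)) UNIV"
        unfolding eq by (intro has_sum_finite_sum has_sum_cmult_right corr S)
      then have "((\<lambda>j. (\<Sum>n\<in>S N. a N n * a N (n + j)) * \<gamma> j) has_sum (\<integral>\<omega>. (A N \<omega>)\<^sup>2 \<partial>M)) UNIV"
        by (simp add: sum_distrib_right mult.assoc add.commute)
      then show ?thesis
        unfolding a_def S_def
        by (rule quadratic_form_bump_samples_le[where N = "Suc N", OF _ tail zero, rotated -1]) simp
    qed
    show "(\<lambda>N. \<integral>\<omega>. f \<omega> * A N \<omega> \<partial>M) \<longlonglongrightarrow> 0" if f: "f \<in> zero_sum_interpolants X" for f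
    proof -
      obtain T c where fT: "f = (\<lambda>\<omega>. \<Sum>n\<in>T. c n * X n \<omega>)"
        using f by (auto simp: zero_sum_interpolants_def)
      have "(\<lambda>N. \<integral>\<omega>. X k \<omega> * A N \<omega> \<partial>M) \<longlonglongrightarrow> 0" for k
      proof (rule has_sum_dominated_tendsto[OF zero _ _ corr])
        show "\<bar>a N (j + k)\<bar> \<le> 1" for N j
          unfolding a_def by (rule abs_bump_le_1)
        show "(\<lambda>N. a N (j + k)) \<longlonglongrightarrow> 1" for j
          unfolding a_def by (rule bump_samples_tendsto)
      qed
      then have "(\<lambda>N. \<Sum>n\<in>T. c n * (\<integral>\<omega>. X n \<omega> * A N \<omega> \<partial>M)) \<longlonglongrightarrow> (\<Sum>n\<in>T. c n * 0)"
        by (intro tendsto_intros)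
      then show ?thesis
        by (simp add: fT integral_lincomb_mult[OF sq sqA])
    qed
  qed
qed

end
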